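(* Let $n\ge 1$ be an integer, $r,s>1$, $\alpha\in(0,n)$, and suppose $\frac1r+\frac1s+\frac{n-\alpha}{n}>2$. Then the best constant $C_{r,s,\alpha}$ in the discrete Hardy-Littlewood-Sobolev inequality is attained: there exist $f\in l^r(\mathbb Z^n)$ and $g\in l^s(\mathbb Z^n)$ with $|f|_{l^r}=|g|_{l^s}=1$ such that $$\sum_{i,j\in\mathbb Z^n,\ i\ne j}\frac{f_i g_j}{|i-j|^{n-\alpha}}=C_{r,s,\alpha}.$$
   Context: Sequences are real-valued and indexed by $\mathbb Z^n$; $|i-j|$ is the Euclidean norm; $|f|_{l^r}=\left(\sum_{i\in\mathbb Z^n}|f_i|^r\right)^{1/r}$. For $r,s>1$, $0<\alpha<n$ and $\frac1r+\frac1s+\frac{n-\alpha}{n}\ge 2$, the discrete Hardy-Littlewood-Sobolev inequality states that there is a finite constant $C$ such that $$\sum_{i,j\in\mathbb Z^n,\ i\neq j}\frac{f_i g_j}{|i-j|^{n-\alpha}}\le C\,|f|_{l^r}|g|_{l^s}\qquad\text{for all } f\in l^r(\mathbb Z^n),\ g\in l^s(\mathbb Z^n).$$ The best constant $C_{r,s,\alpha}$ is the smallest such $C$ (it also depends on $n$). *)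

theory Defs
  imports "HOL-Analysis.Analysis"
begin

text \<open>
  Sequences on the lattice \<open>\<int>\<^sup>n\<close> are functions \<open>int ^ 'n \<Rightarrow> real\<close> with \<open>n = CARD('n)\<close>.
  All infinite sums are unordered sums, so for real summands
  \<^const>\<open>summable_on\<close> means absolute convergence.
\<close>

definition lattice_embed :: "int ^ 'n \<Rightarrow> real ^ 'n" where
  "lattice_embed i = (\<chi> k. real_of_int (i $ k))"

definition lp_space :: "real \<Rightarrow> (int ^ 'n \<Rightarrow> real) set" where
  "lp_space r = {f. (\<lambda>i. \<bar>f i\<bar> powr r) summable_on UNIV}"

definition lp_norm :: "real \<Rightarrow> (int ^ 'n \<Rightarrow> real) \<Rightarrow> real" where
  "lp_norm r f = (\<Sum>\<^sub>\<infinity>i\<in>UNIV. \<bar>f i\<bar> powr r) powr (1 / r)"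

definition hls_term ::
  "real \<Rightarrow> (int ^ 'n \<Rightarrow> real) \<Rightarrow> (int ^ 'n \<Rightarrow> real) \<Rightarrow> (int ^ 'n) \<times> (int ^ 'n) \<Rightarrow> real" where
  "hls_term \<alpha> f g = (\<lambda>(i, j).
     f i * g j / norm (lattice_embed i - lattice_embed j) powr (real CARD('n) - \<alpha>))"

definition off_diagonal :: "((int ^ 'n) \<times> (int ^ 'n)) set" where
  "off_diagonal = {(i, j). i \<noteq> j}"

definition hls_sum ::
  "real \<Rightarrow> (int ^ 'n \<Rightarrow> real) \<Rightarrow> (int ^ 'n \<Rightarrow> real) \<Rightarrow> real" where
  "hls_sum \<alpha> f g = (\<Sum>\<^sub>\<infinity>p\<in>off_diagonal. hls_term \<alpha> f g p)"

text \<open>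
  Since \<^const>\<open>infsum\<close> returns 0 for a divergent sum, convergence of the double series has
  to be demanded explicitly as part of the inequality.  The dimension is passed as a type.
\<close>

definition hls_inequality :: "'n::finite itself \<Rightarrow> real \<Rightarrow> real \<Rightarrow> real \<Rightarrow> real \<Rightarrow> bool" where
  "hls_inequality _ r s \<alpha> C \<longleftrightarrow>
     (\<forall>f \<in> lp_space r. \<forall>g \<in> lp_space s.
        hls_term \<alpha> f (g :: int ^ 'n \<Rightarrow> real) summable_on off_diagonal \<and>
        hls_sum \<alpha> f g \<le> C * lp_norm r f * lp_norm s g)"

definition hls_best_constant :: "'n::finite itself \<Rightarrow> real \<Rightarrow> real \<Rightarrow> real \<Rightarrow> real" where
  "hls_best_constant T r s \<alpha> = (LEAST C. hls_inequality T r s \<alpha> C)"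

end

theory Submission
  imports Defs "HOL-Complex_Analysis.Great_Picard"
begin

text \<open>
  Because the exponents are strictly supercritical, the kernel lies in some \<open>l^t\<close> for which Young's
  inequality yields the Hardy--Littlewood--Sobolev inequality, and there is room to increase \<open>r\<close>
  slightly.  The latter prevents the entries of a maximising sequence \<open>(F\<^sub>n, G\<^sub>n)\<close> from tending
  uniformly to 0, so after a translation a subsequence converges pointwise to some \<open>(f, g)\<close> with
  \<open>f \<noteq> 0\<close>.  Perturbing single entries shows that the limit satisfies the Euler--Lagrange
  equations with multiplier \<open>C\<close>; summing these gives, for the double series \<open>B\<close>,
  \<open>B(f, g) = C \<Sum>\<bar>f\<bar>^r = C \<Sum>\<bar>g\<bar>^s\<close>.  With \<open>a\<close> for the common value of the two sums,
  \<open>0 < a \<le> 1\<close>, the inequality reads \<open>a \<le> a^(1/r + 1/s)\<close>, and \<open>1/r + 1/s > 1\<close> forces \<open>a = 1\<close>.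
\<close>

section \<open>Unordered sums over products and over the integer lattice\<close>

lemma summable_on_nonneg_product:
  fixes f :: "'a \<Rightarrow> real" and g :: "'b \<Rightarrow> real"
  assumes "f summable_on UNIV" "g summable_on UNIV" "\<And>x. f x \<ge> 0" "\<And>y. g y \<ge> 0"
  shows "(\<lambda>(x, y). f x * g y) summable_on UNIV"
proof -
  have "(\<lambda>(x, y). f x * g y) summable_on UNIV \<times> UNIV"
  proof (rule summable_on_SigmaI)
    show "((\<lambda>y. case (x, y) of (x, y) \<Rightarrow> f x * g y) has_sum f x * infsum g UNIV) UNIV" for x
      using assms(2) by (auto intro!: has_sum_cmult_right has_sum_infsum)
    show "(\<lambda>x. f x * infsum g UNIV) summable_on UNIV"
      using assms(1) by (rule summable_on_cmult_left)
  qed (use assms in auto)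
  then show ?thesis by simp
qed

lemma infsum_product:
  fixes f :: "'a \<Rightarrow> real" and g :: "'b \<Rightarrow> real"
  assumes "(\<lambda>(x, y). f x * g y) summable_on UNIV"
  shows "(\<Sum>\<^sub>\<infinity>(x, y)\<in>UNIV. f x * g y) = infsum f UNIV * infsum g UNIV"
proof -
  have "(\<Sum>\<^sub>\<infinity>x. \<Sum>\<^sub>\<infinity>y. f x * g y) = (\<Sum>\<^sub>\<infinity>(x, y)\<in>UNIV \<times> UNIV. f x * g y)"
    by (rule infsum_Sigma'_banach) (use assms in simp)
  then show ?thesis
    by (simp add: infsum_cmult_right' infsum_cmult_left')
qed

text \<open>Each factor is at most the corresponding power of the total \<open>x + y + z\<close>,
  and the exponents add up to 1. This crude form of the weighted AM-GM inequality is enough because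
  only finiteness of the resulting bounds matters.\<close>

lemma powr_prod3_le_add:
  fixes x y z a b c :: real
  assumes "x \<ge> 0" "y \<ge> 0" "z \<ge> 0" "a \<ge> 0" "b \<ge> 0" "c \<ge> 0" "a + b + c = 1"
  shows "x powr a * y powr b * z powr c \<le> x + y + z"
proof -
  let ?m = "x + y + z"
  have "x powr a * y powr b * z powr c \<le> ?m powr a * ?m powr b * ?m powr c"
    by (intro mult_mono powr_mono2) (use assms in auto)
  also have "\<dots> = ?m powr (a + b + c)"
    by (simp add: powr_add)
  also have "\<dots> = ?m"
    using assms by simp
  finally show ?thesis .
qed

lemma summable_on_int_powr:
  fixes q :: real
  assumes "q > 1"
  shows "(\<lambda>k::int. (1 + \<bar>real_of_int k\<bar>) powr - q) summable_on UNIV"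
proof -
  let ?h = "\<lambda>k::int. (1 + \<bar>real_of_int k\<bar>) powr - q"
  have "summable (\<lambda>n. real n powr - q)"
    using assms by (simp add: summable_real_powr_iff)
  then have "summable (\<lambda>n. real (Suc n) powr - q)"
    by (subst summable_Suc_iff)
  then have "(\<lambda>n::nat. real (Suc n) powr - q) summable_on UNIV"
    by (subst summable_on_UNIV_nonneg_real_iff) auto
  then have *: "(\<lambda>n::nat. (1 + real n) powr - q) summable_on UNIV"
    by (simp add: add.commute)
  have "?h summable_on range (\<lambda>n::nat. int n)"
    by (subst summable_on_reindex) (use * in \<open>auto simp: o_def\<close>)
  moreover have "?h summable_on range (\<lambda>n::nat. - int n)"
    by (subst summable_on_reindex) (use * in \<open>auto simp: o_def inj_on_def\<close>)
  ultimately have "?h summable_on (range (\<lambda>n::nat. int n) \<union> range (\<lambda>n::nat. - int n))"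
    by (rule summable_on_union)
  also have "range (\<lambda>n::nat. int n) \<union> range (\<lambda>n::nat. - int n) = UNIV"
  proof -
    have "k \<in> range (\<lambda>n::nat. int n) \<union> range (\<lambda>n::nat. - int n)" for k
      by (cases k rule: int_cases2) auto
    then show ?thesis by blast
  qed
  finally show ?thesis .
qed

text \<open>A finite set of vectors lies in a box with the same finite side \<open>B\<close> in
  every coordinate. The sum over the box factorises into one-dimensional sums, each at most the full
  sum of \<open>h\<close>.\<close>

lemma summable_on_vec_prod:
  fixes h :: "'a \<Rightarrow> real"
  assumes "h summable_on UNIV" "\<And>x. h x \<ge> 0"
  shows "(\<lambda>k :: 'a ^ 'n. \<Prod>i\<in>UNIV. h (k $ i)) summable_on UNIV"
proof (rule nonneg_bdd_above_summable_on)
  show "bdd_above (sum (\<lambda>k :: 'a ^ 'n. \<Prod>i\<in>UNIV. h (k $ i)) ` {F. F \<subseteq> UNIV \<and> finite F})"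
  proof (rule bdd_aboveI2)
    fix F :: "('a ^ 'n) set"
    assume "F \<in> {F. F \<subseteq> UNIV \<and> finite F}"
    then have F: "finite F" by simp
    define B where "B = (\<Union>k\<in>F. range (vec_nth k))"
    have B: "finite B" unfolding B_def using F by auto
    have "(\<Sum>k\<in>F. \<Prod>i\<in>UNIV. h (k $ i)) = (\<Sum>g\<in>vec_nth ` F. \<Prod>i\<in>(UNIV::'n set). h (g i))"
      by (subst sum.reindex) (auto simp: inj_on_def vec_nth_inject)
    also have "\<dots> \<le> (\<Sum>g\<in>PiE UNIV (\<lambda>_. B). \<Prod>i\<in>(UNIV::'n set). h (g i))"
      by (rule sum_mono2) (auto simp: B_def assms(2) intro!: finite_PiE prod_nonneg F)
    also have "\<dots> = (\<Prod>i\<in>(UNIV::'n set). \<Sum>x\<in>B. h x)"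
      by (subst prod_sum_PiE) (auto simp: B)
    also have "\<dots> \<le> (\<Prod>i\<in>(UNIV::'n set). infsum h UNIV)"
      by (intro prod_mono conjI sum_nonneg finite_sum_le_infsum) (auto simp: assms B)
    finally show "(\<Sum>k\<in>F. \<Prod>i\<in>UNIV. h (k $ i)) \<le> (\<Prod>i\<in>(UNIV::'n set). infsum h UNIV)" .
  qed
qed (auto intro!: prod_nonneg assms)

subsection \<open>The kernel on the lattice\<close>

text \<open>
  Since \<open>x / 0 = 0\<close>, the kernel vanishes at the origin, which encodes the restriction to
  off-diagonal pairs.
\<close>

definition riesz_kernel :: "real \<Rightarrow> int ^ 'n \<Rightarrow> real" where
  "riesz_kernel \<alpha> k = 1 / norm (lattice_embed k) powr (real CARD('n) - \<alpha>)"

lemma lattice_embed_diff: "lattice_embed i - lattice_embed j = lattice_embed (i - j)"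
  by (simp add: lattice_embed_def vec_eq_iff)

lemma lattice_embed_eq_0_iff [simp]: "lattice_embed k = 0 \<longleftrightarrow> k = 0"
  by (simp add: lattice_embed_def vec_eq_iff)

lemma riesz_kernel_nonneg [simp]: "riesz_kernel \<alpha> k \<ge> 0"
  by (simp add: riesz_kernel_def)

lemma riesz_kernel_0 [simp]: "riesz_kernel \<alpha> 0 = 0"
  by (simp add: riesz_kernel_def)

lemma riesz_kernel_minus: "riesz_kernel \<alpha> (i - j) = riesz_kernel \<alpha> (j - i)"
  by (simp add: riesz_kernel_def flip: lattice_embed_diff) (simp add: norm_minus_commute)

lemma norm_lattice_embed_ge_1:
  assumes "k \<noteq> 0"
  shows "norm (lattice_embed k) \<ge> 1"
proof -
  obtain i where "k $ i \<noteq> 0"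
    using assms by (auto simp: vec_eq_iff)
  then have "1 \<le> \<bar>lattice_embed k $ i\<bar>"
    by (simp add: lattice_embed_def)
  also have "\<dots> \<le> norm (lattice_embed k)"
    by (rule component_le_norm_cart)
  finally show ?thesis .
qed

lemma hls_term_eq: "hls_term \<alpha> f g (i, j) = f i * g j * riesz_kernel \<alpha> (i - j)"
  by (simp add: hls_term_def riesz_kernel_def lattice_embed_diff)

text \<open>The total decay exponent \<open>p\<close> is spread evenly over the coordinates,
  \<open>q = p / n\<close> for each. A nonzero \<open>k\<close> of norm \<open>N\<close> satisfies
  \<open>1 + \<bar>k $ i\<bar> \<le> 2 * N\<close>, so \<open>N powr - p\<close> is dominated by a
  product of one-dimensional terms. These are summable since \<open>q > 1\<close>, and the factor
  \<open>2 powr p\<close> pays for the 2 in \<open>2 * N\<close>.\<close>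

lemma riesz_kernel_powr_summable:
  assumes "t \<ge> 0" and "(real CARD('n) - \<alpha>) * t > real CARD('n)"
  shows "(\<lambda>k :: int ^ 'n::finite. riesz_kernel \<alpha> k powr t) summable_on UNIV"
proof -
  define n where "n = real CARD('n)"
  define p where "p = (n - \<alpha>) * t"
  define q where "q = p / n"
  have n: "n > 0" by (simp add: n_def)
  have p: "p > n" using assms(2) by (simp add: p_def n_def)
  have q: "q > 1" using p n by (simp add: q_def)
  let ?h = "\<lambda>m::int. (1 + \<bar>real_of_int m\<bar>) powr - q"
  have "(\<lambda>k :: int ^ 'n. 2 powr p * (\<Prod>i\<in>UNIV. ?h (k $ i))) summable_on UNIV"
    by (intro summable_on_cmult_right summable_on_vec_prod summable_on_int_powr q) auto
  then show ?thesis
  proof (rule summable_on_comparison_test)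
    fix k :: "int ^ 'n"
    show "riesz_kernel \<alpha> k powr t \<le> 2 powr p * (\<Prod>i\<in>UNIV. ?h (k $ i))"
    proof (cases "k = 0")
      case False
      define N where "N = norm (lattice_embed k)"
      have N: "N \<ge> 1" unfolding N_def using norm_lattice_embed_ge_1[OF False] .
      have "(2 * N) powr - q \<le> ?h (k $ i)" for i
      proof (rule powr_mono2')
        have "\<bar>lattice_embed k $ i\<bar> \<le> N"
          unfolding N_def by (rule component_le_norm_cart)
        then show "1 + \<bar>real_of_int (k $ i)\<bar> \<le> 2 * N"
          using N by (simp add: lattice_embed_def)
      qed (use q in auto)
      then have "(\<Prod>i\<in>(UNIV::'n set). (2 * N) powr - q) \<le> (\<Prod>i\<in>UNIV. ?h (k $ i))"
        by (intro prod_mono) auto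
      also have "(\<Prod>i\<in>(UNIV::'n set). (2 * N) powr - q) = (2 * N) powr (- p)"
        using N n by (simp add: powr_power q_def n_def)
      finally have "2 powr p * (2 * N) powr (- p) \<le> 2 powr p * (\<Prod>i\<in>UNIV. ?h (k $ i))"
        by (intro mult_left_mono) auto
      moreover have "2 powr p * (2 * N) powr (- p) = N powr - p"
        using N by (simp add: powr_mult powr_minus)
      moreover have "riesz_kernel \<alpha> k powr t = N powr - p"
        using N by (simp add: riesz_kernel_def N_def[symmetric] p_def n_def powr_divide powr_powr
            powr_minus_divide)
      ultimately show ?thesis by simp
    qed (auto intro!: mult_nonneg_nonneg prod_nonneg)
  qed auto
qed

subsection \<open>The inequality\<close>

lemma hls_term_diagonal [simp]: "hls_term \<alpha> f g (i, i) = 0"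
  by (simp add: hls_term_eq)

lemma summable_on_off_diagonal_iff:
  "hls_term \<alpha> f g summable_on off_diagonal \<longleftrightarrow> hls_term \<alpha> f g summable_on UNIV"
  by (rule summable_on_cong_neutral) (auto simp: off_diagonal_def)

lemma hls_sum_eq_UNIV: "hls_sum \<alpha> f g = (\<Sum>\<^sub>\<infinity>p. hls_term \<alpha> f g p)"
  unfolding hls_sum_def by (rule infsum_cong_neutral) (auto simp: off_diagonal_def)

text \<open>The substitutions taking \<open>(i, j)\<close> to \<open>(j, i - j)\<close> and to
  \<open>(i, i - j)\<close> are bijections that separate the variables.\<close>

lemma has_sum_difference_kernel:
  fixes h \<kappa> :: "'a::ab_group_add \<Rightarrow> real"
  assumes "h summable_on UNIV" "\<kappa> summable_on UNIV" "\<And>x. h x \<ge> 0" "\<And>x. \<kappa> x \<ge> 0"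
  shows "((\<lambda>(i, j). h j * \<kappa> (i - j)) has_sum infsum h UNIV * infsum \<kappa> UNIV) UNIV"
    and "((\<lambda>(i, j). h i * \<kappa> (i - j)) has_sum infsum h UNIV * infsum \<kappa> UNIV) UNIV"
proof -
  have sm: "(\<lambda>(x, y). h x * \<kappa> y) summable_on UNIV"
    by (rule summable_on_nonneg_product) (use assms in auto)
  then have hs: "((\<lambda>(x, y). h x * \<kappa> y) has_sum infsum h UNIV * infsum \<kappa> UNIV) UNIV"
    by (simp add: has_sum_iff infsum_product)
  have 1: "bij_betw (\<lambda>(i, j). (j, i - j)) UNIV (UNIV :: ('a \<times> 'a) set)"
    by (rule bij_betwI[where g = "\<lambda>(x, y). (x + y, x)"]) auto
  have 2: "bij_betw (\<lambda>(i, j). (i, i - j)) UNIV (UNIV :: ('a \<times> 'a) set)"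
    by (rule bij_betwI[where g = "\<lambda>(x, y). (x, x - y)"]) auto
  show "((\<lambda>(i, j). h j * \<kappa> (i - j)) has_sum infsum h UNIV * infsum \<kappa> UNIV) UNIV"
    using has_sum_reindex_bij_betw[OF 1, of "\<lambda>(x, y). h x * \<kappa> y"] hs
    by (simp add: case_prod_unfold)
  show "((\<lambda>(i, j). h i * \<kappa> (i - j)) has_sum infsum h UNIV * infsum \<kappa> UNIV) UNIV"
    using has_sum_reindex_bij_betw[OF 2, of "\<lambda>(x, y). h x * \<kappa> y"] hs
    by (simp add: case_prod_unfold)
qed

text \<open>
  With \<open>t = 1 / \<tau>\<close>, this rests on the factorisation
  \<open>x y z = (x^r y^s)^(1 - \<tau>) (y^s z^t)^(1 - 1/r) (x^r z^t)^(1 - 1/s)\<close>,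
  whose outer exponents add up to 1.
\<close>

lemma young_pointwise:
  fixes x y z r s \<tau> :: real
  assumes "x \<ge> 0" "y \<ge> 0" "z \<ge> 0" "r > 1" "s > 1" "0 < \<tau>" "\<tau> \<le> 1" "1 / r + 1 / s + \<tau> = 2"
  shows "x * y * z \<le> x powr r * y powr s + y powr s * z powr (1 / \<tau>) + x powr r * z powr (1 / \<tau>)"
proof -
  let ?t = "1 / \<tau>"
  have "(x powr r * y powr s) powr (1 - \<tau>) * (y powr s * z powr ?t) powr (1 - 1 / r) *
      (x powr r * z powr ?t) powr (1 - 1 / s)
    = (x powr (r * (1 - \<tau>)) * x powr (r * (1 - 1 / s))) *
      (y powr (s * (1 - \<tau>)) * y powr (s * (1 - 1 / r))) *
      (z powr (?t * (1 - 1 / r)) * z powr (?t * (1 - 1 / s)))"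
    by (simp add: powr_mult powr_powr mult_ac)
  also have "\<dots> = x powr (r * (1 - \<tau> + (1 - 1 / s))) * y powr (s * (1 - \<tau> + (1 - 1 / r))) *
      z powr (?t * (1 - 1 / r + (1 - 1 / s)))"
    by (simp only: powr_add[symmetric] distrib_left)
  also have "1 - \<tau> + (1 - 1 / s) = 1 / r"
    using assms(8) by linarith
  also have "1 - \<tau> + (1 - 1 / r) = 1 / s"
    using assms(8) by linarith
  also have "1 - 1 / r + (1 - 1 / s) = \<tau>"
    using assms(8) by linarith
  also have "x powr (r * (1 / r)) * y powr (s * (1 / s)) * z powr (?t * \<tau>) = x * y * z"
    using assms by simp
  finally have "x * y * z = (x powr r * y powr s) powr (1 - \<tau>) *
      (y powr s * z powr ?t) powr (1 - 1 / r) * (x powr r * z powr ?t) powr (1 - 1 / s)"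
    by simp
  also have "\<dots> \<le> x powr r * y powr s + y powr s * z powr ?t + x powr r * z powr ?t"
    by (rule powr_prod3_le_add) (use assms in auto)
  finally show ?thesis .
qed

text \<open>Summing \<open>young_pointwise\<close> over all pairs gives three separated sums, with
  \<open>A\<close> the sum of the kernel raised to the power \<open>1 / \<tau>\<close>. The bound is
  therefore additive in the two power sums; homogeneity later turns it into a product of
  norms.\<close>

lemma hls_young:
  fixes r s \<alpha> :: real
  assumes "r > 1" and "s > 1" and "0 < \<alpha>" and "\<alpha> < real CARD('n::finite)"
    and "1 / r + 1 / s + (real CARD('n) - \<alpha>) / real CARD('n) > 2"
  obtains A where "A \<ge> 0"
    and "\<And>f g :: int ^ 'n \<Rightarrow> real. f \<in> lp_space r \<Longrightarrow> g \<in> lp_space s \<Longrightarrow> hls_term \<alpha> f g summable_on UNIV"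
    and "\<And>f g :: int ^ 'n \<Rightarrow> real. f \<in> lp_space r \<Longrightarrow> g \<in> lp_space s \<Longrightarrow>
      hls_sum \<alpha> f g \<le> (\<Sum>\<^sub>\<infinity>i. \<bar>f i\<bar> powr r) * (\<Sum>\<^sub>\<infinity>i. \<bar>g i\<bar> powr s) +
        (\<Sum>\<^sub>\<infinity>i. \<bar>g i\<bar> powr s) * A + (\<Sum>\<^sub>\<infinity>i. \<bar>f i\<bar> powr r) * A"
proof -
  \<comment> \<open>This is the exponent balance required by Young's inequality. The strict
    hypothesis puts \<tau> below \<open>(n - \<alpha>) / n\<close>, which is exactly what makes the
    kernel to the power \<open>1 / \<tau>\<close> summable.\<close>
  define \<tau> where "\<tau> = 2 - 1 / r - 1 / s"
  have r: "1 / r < 1" and s: "1 / s < 1" using assms by auto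
  have "(real CARD('n) - \<alpha>) / real CARD('n) < 1" using assms by simp
  with r s assms(5) have \<tau>: "0 < \<tau>" "\<tau> < 1" "\<tau> < (real CARD('n) - \<alpha>) / real CARD('n)"
    unfolding \<tau>_def by linarith+
  define \<kappa> :: "int ^ 'n \<Rightarrow> real" where "\<kappa> k = riesz_kernel \<alpha> k powr (1 / \<tau>)" for k
  have \<kappa>: "\<kappa> summable_on UNIV"
    unfolding \<kappa>_def
    by (rule riesz_kernel_powr_summable) (use \<tau> in \<open>auto simp: field_simps\<close>)
  have \<kappa>0: "\<kappa> k \<ge> 0" for k by (simp add: \<kappa>_def)
  define A where "A = infsum \<kappa> UNIV"
  have *: "hls_term \<alpha> f g summable_on UNIV \<and>
      hls_sum \<alpha> f g \<le> (\<Sum>\<^sub>\<infinity>i. \<bar>f i\<bar> powr r) * (\<Sum>\<^sub>\<infinity>i. \<bar>g i\<bar> powr s) +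
        (\<Sum>\<^sub>\<infinity>i. \<bar>g i\<bar> powr s) * A + (\<Sum>\<^sub>\<infinity>i. \<bar>f i\<bar> powr r) * A"
    if f: "f \<in> lp_space r" and g: "g \<in> lp_space s" for f g :: "int ^ 'n \<Rightarrow> real"
  proof -
    define F where "F i = \<bar>f i\<bar> powr r" for i
    define G where "G i = \<bar>g i\<bar> powr s" for i
    have F: "F summable_on UNIV" and G: "G summable_on UNIV"
      using f g by (auto simp: lp_space_def F_def[abs_def] G_def[abs_def])
    have F0: "F i \<ge> 0" and G0: "G i \<ge> 0" for i by (auto simp: F_def G_def)
    let ?b = "\<lambda>p. (case p of (i, j) \<Rightarrow> F i * G j) + (case p of (i, j) \<Rightarrow> G j * \<kappa> (i - j)) +
      (case p of (i, j) \<Rightarrow> F i * \<kappa> (i - j))"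
    have "((\<lambda>(i, j). F i * G j) has_sum infsum F UNIV * infsum G UNIV) UNIV"
      using summable_on_nonneg_product[OF F G F0 G0] by (simp add: has_sum_iff infsum_product)
    then have b: "(?b has_sum (infsum F UNIV * infsum G UNIV + infsum G UNIV * A + infsum F UNIV * A)) UNIV"
      unfolding A_def using F G \<kappa> F0 G0 \<kappa>0 by (intro has_sum_add has_sum_difference_kernel)
    have le: "\<bar>hls_term \<alpha> f g p\<bar> \<le> ?b p" for p
    proof (cases p)
      case (Pair i j)
      then show ?thesis
        using young_pointwise[of "\<bar>f i\<bar>" "\<bar>g j\<bar>" "riesz_kernel \<alpha> (i - j)" r s \<tau>] assms \<tau>
        by (simp add: hls_term_eq abs_mult F_def G_def \<kappa>_def \<tau>_def)
    qed
    have "(\<lambda>p. norm (hls_term \<alpha> f g p)) summable_on UNIV"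
      by (rule summable_on_comparison_test[of ?b]) (use b le in \<open>auto simp: summable_on_def\<close>)
    then have sm: "hls_term \<alpha> f g summable_on UNIV"
      by (rule abs_summable_summable)
    have "hls_sum \<alpha> f g \<le> infsum F UNIV * infsum G UNIV + infsum G UNIV * A + infsum F UNIV * A"
      unfolding hls_sum_eq_UNIV
      by (rule has_sum_mono[OF has_sum_infsum[OF sm] b]) (use le abs_le_D1 in blast)
    with sm show ?thesis
      by (simp add: F_def[abs_def] G_def[abs_def])
  qed
  have "A \<ge> 0" unfolding A_def by (rule infsum_nonneg) (use \<kappa>0 in auto)
  with * show ?thesis using that by blast
qed

section \<open>Homogeneity and normalisation\<close>

lemma infsum_abs_powr_nonneg: "(\<Sum>\<^sub>\<infinity>i. \<bar>f i\<bar> powr r :: real) \<ge> 0"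
  by (rule infsum_nonneg) simp

lemma lp_norm_nonneg [simp]: "lp_norm r f \<ge> 0"
  by (simp add: lp_norm_def)

lemma lp_norm_powr:
  assumes "r > 0"
  shows "lp_norm r f powr r = (\<Sum>\<^sub>\<infinity>i. \<bar>f i\<bar> powr r)"
  using assms infsum_abs_powr_nonneg[of f r] by (simp add: lp_norm_def powr_powr)

lemma lp_norm_eq_1_iff:
  assumes "r > 0"
  shows "lp_norm r f = 1 \<longleftrightarrow> (\<Sum>\<^sub>\<infinity>i. \<bar>f i\<bar> powr r) = 1"
proof
  assume "lp_norm r f = 1"
  then show "(\<Sum>\<^sub>\<infinity>i. \<bar>f i\<bar> powr r) = 1" using lp_norm_powr[OF assms, of f] by simp
qed (simp add: lp_norm_def)

lemma lp_norm_eq_0D: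
  assumes "r > 0" "f \<in> lp_space r" "lp_norm r f = 0"
  shows "f = (\<lambda>_. 0)"
proof
  fix i
  have "\<bar>f i\<bar> powr r = 0"
    by (rule nonneg_infsum_le_0D[where A = UNIV])
      (use assms lp_norm_powr[of r f] in \<open>auto simp: lp_space_def\<close>)
  then show "f i = 0" by simp
qed

lemma lp_space_scale:
  assumes "f \<in> lp_space r"
  shows "(\<lambda>i. c * f i) \<in> lp_space r"
  using assms by (auto simp: lp_space_def abs_mult powr_mult intro!: summable_on_cmult_right)

lemma lp_norm_scale:
  assumes "r > 0"
  shows "lp_norm r (\<lambda>i. c * f i) = \<bar>c\<bar> * lp_norm r f"
  using assms infsum_abs_powr_nonneg[of f r]
  by (simp add: lp_norm_def abs_mult powr_mult infsum_cmult_right' powr_powr)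

lemma hls_sum_scale: "hls_sum \<alpha> (\<lambda>i. c * f i) (\<lambda>j. d * g j) = c * d * hls_sum \<alpha> f g"
proof -
  have "hls_term \<alpha> (\<lambda>i. c * f i) (\<lambda>j. d * g j) = (\<lambda>p. c * d * hls_term \<alpha> f g p)"
    by (auto simp: hls_term_def)
  then show ?thesis by (simp add: hls_sum_def infsum_cmult_right')
qed

lemma hls_sum_zero [simp]: "hls_sum \<alpha> (\<lambda>_. 0) g = 0" "hls_sum \<alpha> f (\<lambda>_. 0) = 0"
  by (simp_all add: hls_sum_def hls_term_def case_prod_unfold)

lemma hls_normalize:
  fixes f g :: "int ^ 'n::finite \<Rightarrow> real"
  assumes "r > 0" "s > 0" "f \<in> lp_space r" "g \<in> lp_space s" "lp_norm r f \<noteq> 0" "lp_norm s g \<noteq> 0"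
  obtains f' g' :: "int ^ 'n \<Rightarrow> real"
  where "f' \<in> lp_space r" "g' \<in> lp_space s" "lp_norm r f' = 1" "lp_norm s g' = 1"
    "hls_sum \<alpha> f g = hls_sum \<alpha> f' g' * lp_norm r f * lp_norm s g"
proof
  let ?f = "\<lambda>i. (1 / lp_norm r f) * f i" and ?g = "\<lambda>i. (1 / lp_norm s g) * g i"
  show "?f \<in> lp_space r" "?g \<in> lp_space s"
    using assms lp_space_scale by blast+
  show "lp_norm r ?f = 1" "lp_norm s ?g = 1"
    using assms by (simp_all only: lp_norm_scale) simp_all
  show "hls_sum \<alpha> f g = hls_sum \<alpha> ?f ?g * lp_norm r f * lp_norm s g"
    using assms by (simp only: hls_sum_scale) simp
qed

text \<open>On pairs of norm 1 the additive bound of \<open>hls_young\<close> reads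
  \<open>1 + A + A\<close>, and scaling carries this constant over to all pairs of nonzero norm. If
  a norm vanishes, so does the sequence and with it the double series.\<close>

lemma hls_inequality_exists:
  fixes r s \<alpha> :: real
  assumes "r > 1" and "s > 1" and "0 < \<alpha>" and "\<alpha> < real CARD('n::finite)"
    and "1 / r + 1 / s + (real CARD('n) - \<alpha>) / real CARD('n) > 2"
  shows "\<exists>C. hls_inequality TYPE('n) r s \<alpha> C"
proof -
  obtain A where A: "A \<ge> 0"
    and sm: "\<And>f g :: int ^ 'n \<Rightarrow> real. f \<in> lp_space r \<Longrightarrow> g \<in> lp_space s \<Longrightarrow> hls_term \<alpha> f g summable_on UNIV"
    and le: "\<And>f g :: int ^ 'n \<Rightarrow> real. f \<in> lp_space r \<Longrightarrow> g \<in> lp_space s \<Longrightarrow>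
      hls_sum \<alpha> f g \<le> (\<Sum>\<^sub>\<infinity>i. \<bar>f i\<bar> powr r) * (\<Sum>\<^sub>\<infinity>i. \<bar>g i\<bar> powr s) +
        (\<Sum>\<^sub>\<infinity>i. \<bar>g i\<bar> powr s) * A + (\<Sum>\<^sub>\<infinity>i. \<bar>f i\<bar> powr r) * A"
    using hls_young[OF assms] by blast
  have "hls_sum \<alpha> f g \<le> (1 + A + A) * lp_norm r f * lp_norm s g"
    if f: "f \<in> lp_space r" and g: "g \<in> lp_space s" for f g :: "int ^ 'n \<Rightarrow> real"
  proof (cases "lp_norm r f = 0 \<or> lp_norm s g = 0")
    case True
    then have "f = (\<lambda>_. 0) \<or> g = (\<lambda>_. 0)"
      using lp_norm_eq_0D[of r f] lp_norm_eq_0D[of s g] f g assms by auto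
    then have "hls_sum \<alpha> f g = 0" by auto
    then show ?thesis using A by simp
  next
    case False
    then obtain f' g' :: "int ^ 'n \<Rightarrow> real" where *: "f' \<in> lp_space r" "g' \<in> lp_space s" "lp_norm r f' = 1" "lp_norm s g' = 1"
        "hls_sum \<alpha> f g = hls_sum \<alpha> f' g' * lp_norm r f * lp_norm s g"
      using hls_normalize[of r s f g \<alpha>] f g assms by auto
    have "hls_sum \<alpha> f' g' \<le> 1 + A + A"
      using le[OF *(1,2)] *(3,4) assms by (simp add: lp_norm_eq_1_iff)
    then show ?thesis
      unfolding *(5) by (intro mult_right_mono) auto
  qed
  with sm show ?thesis
    unfolding hls_inequality_def summable_on_off_diagonal_iff by blast
qed

subsection \<open>Pointwise limits of bounded sequences\<close>

text \<open>Fatou's lemma for sums: the bound passes to the limit in every finite partial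
  sum.\<close>

lemma infsum_powr_le_limit:
  fixes G :: "nat \<Rightarrow> 'a \<Rightarrow> real"
  assumes "s > 0" "\<And>n. (\<lambda>j. \<bar>G n j\<bar> powr s) summable_on UNIV"
    and "\<And>n. (\<Sum>\<^sub>\<infinity>j. \<bar>G n j\<bar> powr s) \<le> B" "\<And>j. (\<lambda>n. G n j) \<longlonglongrightarrow> g j"
  shows "(\<lambda>j. \<bar>g j\<bar> powr s) summable_on UNIV" "(\<Sum>\<^sub>\<infinity>j. \<bar>g j\<bar> powr s) \<le> B"
proof -
  have *: "(\<Sum>j\<in>A. \<bar>g j\<bar> powr s) \<le> B" if "finite A" for A
  proof (rule LIMSEQ_le_const2)
    have "(\<lambda>n. \<bar>G n j\<bar> powr s) \<longlonglongrightarrow> \<bar>g j\<bar> powr s" for j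
      by (rule tendsto_powr') (use assms in \<open>auto intro!: tendsto_intros\<close>)
    then show "(\<lambda>n. \<Sum>j\<in>A. \<bar>G n j\<bar> powr s) \<longlonglongrightarrow> (\<Sum>j\<in>A. \<bar>g j\<bar> powr s)"
      by (intro tendsto_sum)
    have "(\<Sum>j\<in>A. \<bar>G n j\<bar> powr s) \<le> B" for n
      using finite_sum_le_infsum[OF assms(2), of A n] assms(3)[of n] that by force
    then show "\<exists>N. \<forall>n\<ge>N. (\<Sum>j\<in>A. \<bar>G n j\<bar> powr s) \<le> B" by blast
  qed
  show sm: "(\<lambda>j. \<bar>g j\<bar> powr s) summable_on UNIV"
    by (rule nonneg_bdd_above_summable_on) (use * in \<open>auto intro!: bdd_aboveI2\<close>)
  show "(\<Sum>\<^sub>\<infinity>j. \<bar>g j\<bar> powr s) \<le> B"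
    by (rule infsum_le_finite_sums[OF sm]) (use * in auto)
qed

lemma mult_le_powr_add:
  fixes a b p q :: real
  assumes "p > 1" "q > 1" "1 / p + 1 / q = 1" "a \<ge> 0" "b \<ge> 0"
  shows "a * b \<le> a powr p + b powr q"
proof -
  have "a * b \<le> a powr p / p + b powr q / q"
    by (rule Youngs_inequality) (use assms in auto)
  also have "\<dots> \<le> a powr p / 1 + b powr q / 1"
    by (intro add_mono divide_left_mono) (use assms in auto)
  finally show ?thesis by simp
qed

lemma summable_on_mult_powr:
  fixes K h :: "'a \<Rightarrow> real"
  assumes "p > 1" "q > 1" "1 / p + 1 / q = 1"
    and "(\<lambda>j. K j powr p) summable_on UNIV" "(\<lambda>j. h j powr q) summable_on UNIV"
    and "\<And>j. K j \<ge> 0" "\<And>j. h j \<ge> 0"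
  shows "(\<lambda>j. K j * h j) summable_on UNIV"
  by (rule summable_on_comparison_test[OF summable_on_add[OF assms(4,5)]])
    (use assms mult_le_powr_add in auto)

text \<open>The point is that one finite set serves the whole unit ball of \<open>l^q\<close>.
  Young's inequality is applied to \<open>(K / \<delta>) * (\<delta> * h)\<close>: the choice of
  \<delta> makes the \<open>h\<close> part of any tail at most \<open>\<epsilon> / 2\<close>, and
  \<open>A\<close> then makes the tail of \<open>(K / \<delta>) powr p\<close> equally
  small.\<close>

lemma infsum_mult_uniform_tail:
  fixes K :: "'a \<Rightarrow> real"
  assumes pq: "p > 1" "q > 1" "1 / p + 1 / q = 1"
    and K: "(\<lambda>j. K j powr p) summable_on UNIV" "\<And>j. K j \<ge> 0" and "\<epsilon> > 0"
  obtains A where "finite A"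
    and "\<And>h. (\<lambda>j. h j powr q) summable_on UNIV \<Longrightarrow> (\<And>j. h j \<ge> 0) \<Longrightarrow>
      (\<Sum>\<^sub>\<infinity>j. h j powr q) \<le> 1 \<Longrightarrow> \<bar>(\<Sum>\<^sub>\<infinity>j. K j * h j) - (\<Sum>j\<in>A. K j * h j)\<bar> \<le> \<epsilon>"
proof -
  define \<delta> where "\<delta> = (\<epsilon> / 2) powr (1 / q)"
  have \<delta>: "\<delta> > 0" "\<delta> powr q = \<epsilon> / 2"
    using \<open>\<epsilon> > 0\<close> pq(2) by (simp_all add: \<delta>_def powr_powr)
  let ?L = "\<lambda>j. (K j / \<delta>) powr p"
  have L: "?L summable_on UNIV"
    using summable_on_cmult_left[OF K(1), of "inverse (\<delta> powr p)"] K(2) \<delta>(1)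
    by (simp add: powr_divide divide_inverse[symmetric])
  obtain A where A: "finite A" "dist (sum ?L A) (infsum ?L UNIV) \<le> \<epsilon> / 2"
    using infsum_finite_approximation[OF L, of "\<epsilon> / 2"] \<open>\<epsilon> > 0\<close> by auto
  have split: "infsum u UNIV = sum u A + infsum u (- A)" if "u summable_on UNIV" for u :: "'a \<Rightarrow> real"
    using infsum_Un_disjoint[of u A "- A"] A that
    by (auto intro: summable_on_subset_banach)
  have LA: "infsum ?L (- A) \<le> \<epsilon> / 2"
    using split[OF L] A(2) by (simp add: dist_real_def)
  show ?thesis
  proof (rule that[OF A(1)])
    fix h :: "'a \<Rightarrow> real"
    assume h: "(\<lambda>j. h j powr q) summable_on UNIV" "\<And>j. h j \<ge> 0" "(\<Sum>\<^sub>\<infinity>j. h j powr q) \<le> 1"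
    have sm: "(\<lambda>j. K j * h j) summable_on UNIV"
      by (rule summable_on_mult_powr[OF pq K(1) h(1) K(2) h(2)])
    have sm1: "?L summable_on - A"
      by (rule summable_on_subset_banach[OF L]) simp
    have sm2: "(\<lambda>j. \<delta> powr q * h j powr q) summable_on - A"
      by (rule summable_on_subset_banach[OF summable_on_cmult_right[OF h(1)]]) simp
    have "infsum (\<lambda>j. K j * h j) (- A) \<le> infsum (\<lambda>j. ?L j + \<delta> powr q * h j powr q) (- A)"
    proof (rule infsum_mono)
      show "(\<lambda>j. K j * h j) summable_on - A"
        by (rule summable_on_subset_banach[OF sm]) simp
      show "(\<lambda>j. ?L j + \<delta> powr q * h j powr q) summable_on - A"
        using sm1 sm2 by (rule summable_on_add)
      show "K j * h j \<le> ?L j + \<delta> powr q * h j powr q" for j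
        using mult_le_powr_add[OF pq, of "K j / \<delta>" "\<delta> * h j"] K(2) h(2) \<delta>(1) by (simp add: powr_mult)
    qed
    also have "\<dots> = infsum ?L (- A) + \<delta> powr q * infsum (\<lambda>j. h j powr q) (- A)"
      using sm1 sm2 by (simp add: infsum_add infsum_cmult_right')
    also have "\<dots> \<le> \<epsilon> / 2 + \<delta> powr q * 1"
    proof (intro add_mono mult_left_mono LA)
      have "infsum (\<lambda>j. h j powr q) (- A) \<le> infsum (\<lambda>j. h j powr q) UNIV"
        by (rule infsum_mono2) (use h in \<open>auto intro: summable_on_subset_banach\<close>)
      also note h(3)
      finally show "infsum (\<lambda>j. h j powr q) (- A) \<le> 1" .
    qed simp
    also have "\<dots> = \<epsilon>"
      using \<delta>(2) by simp
    finally have "infsum (\<lambda>j. K j * h j) (- A) \<le> \<epsilon>" .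
    moreover have "infsum (\<lambda>j. K j * h j) (- A) \<ge> 0"
      by (rule infsum_nonneg) (use K h in auto)
    ultimately show "\<bar>(\<Sum>\<^sub>\<infinity>j. K j * h j) - (\<Sum>j\<in>A. K j * h j)\<bar> \<le> \<epsilon>"
      using split[OF sm] by simp
  qed
qed

text \<open>Boundedness in \<open>l^q\<close> and pointwise convergence give weak convergence
  against the dual space \<open>l^p\<close>. On the finite set \<open>A\<close> the limit is
  elementary, and the two tails, of \<open>G n\<close> and of \<open>g\<close>, cost at most
  \<open>e / 4\<close> each.\<close>

lemma infsum_mult_tendsto:
  fixes K g :: "'a \<Rightarrow> real" and G :: "nat \<Rightarrow> 'a \<Rightarrow> real"
  assumes pq: "p > 1" "q > 1" "1 / p + 1 / q = 1"
    and K: "(\<lambda>j. K j powr p) summable_on UNIV" "\<And>j. K j \<ge> 0"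
    and G: "\<And>n. (\<lambda>j. G n j powr q) summable_on UNIV" "\<And>n j. G n j \<ge> 0"
      "\<And>n. (\<Sum>\<^sub>\<infinity>j. G n j powr q) \<le> 1"
    and lim: "\<And>j. (\<lambda>n. G n j) \<longlonglongrightarrow> g j"
  shows "(\<lambda>n. \<Sum>\<^sub>\<infinity>j. K j * G n j) \<longlonglongrightarrow> (\<Sum>\<^sub>\<infinity>j. K j * g j)"
proof (rule LIMSEQ_I)
  fix e :: real
  assume "e > 0"
  have g0: "g j \<ge> 0" for j
    using LIMSEQ_le_const[OF lim[of j]] G(2) by blast
  have g: "(\<lambda>j. g j powr q) summable_on UNIV" "(\<Sum>\<^sub>\<infinity>j. g j powr q) \<le> 1"
    using infsum_powr_le_limit[of q G 1 g] pq G lim g0 by simp_all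
  obtain A where A: "finite A"
    "\<And>h. (\<lambda>j. h j powr q) summable_on UNIV \<Longrightarrow> (\<And>j. h j \<ge> 0) \<Longrightarrow>
      (\<Sum>\<^sub>\<infinity>j. h j powr q) \<le> 1 \<Longrightarrow> \<bar>(\<Sum>\<^sub>\<infinity>j. K j * h j) - (\<Sum>j\<in>A. K j * h j)\<bar> \<le> e / 4"
    using infsum_mult_uniform_tail[OF pq K, of "e / 4"] \<open>e > 0\<close> by auto
  have "(\<lambda>n. \<Sum>j\<in>A. K j * G n j) \<longlonglongrightarrow> (\<Sum>j\<in>A. K j * g j)"
    by (intro tendsto_intros lim)
  then obtain N where N: "\<And>n. n \<ge> N \<Longrightarrow> norm ((\<Sum>j\<in>A. K j * G n j) - (\<Sum>j\<in>A. K j * g j)) < e / 4"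
    using \<open>e > 0\<close> by (meson LIMSEQ_D divide_pos_pos zero_less_numeral)
  have "norm ((\<Sum>\<^sub>\<infinity>j. K j * G n j) - (\<Sum>\<^sub>\<infinity>j. K j * g j)) < e" if "n \<ge> N" for n
    using N[OF that] A(2)[OF G(1)[of n] G(2) G(3)] A(2)[OF g(1) g0 g(2)] \<open>e > 0\<close>
    unfolding real_norm_def by argo
  then show "\<exists>N. \<forall>n\<ge>N. norm ((\<Sum>\<^sub>\<infinity>j. K j * G n j) - (\<Sum>\<^sub>\<infinity>j. K j * g j)) < e" by blast
qed

text \<open>Convolution with the kernel, and the partial derivative of \<open>hls_sum\<close> with
  respect to the entry \<open>f i\<close>. The term \<open>j = i\<close> drops out because the
  kernel vanishes at the origin.\<close>

definition riesz_potential :: "real \<Rightarrow> (int ^ 'n \<Rightarrow> real) \<Rightarrow> int ^ 'n \<Rightarrow> real" where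
  "riesz_potential \<alpha> g i = (\<Sum>\<^sub>\<infinity>j. riesz_kernel \<alpha> (i - j) * g j)"

text \<open>Fubini, with the sum over \<open>j\<close> taken first; joint summability also
  guarantees convergence of the outer series.\<close>

lemma has_sum_riesz_potential:
  assumes "hls_term \<alpha> f g summable_on UNIV"
  shows "((\<lambda>i. f i * riesz_potential \<alpha> g i) has_sum hls_sum \<alpha> f g) UNIV"
proof -
  let ?t = "\<lambda>i j. f i * (riesz_kernel \<alpha> (i - j) * g j)"
  have eq: "hls_term \<alpha> f g = (\<lambda>(i, j). ?t i j)"
    by (auto simp: hls_term_eq mult_ac)
  have sm: "(\<lambda>(i, j). ?t i j) summable_on UNIV \<times> UNIV"
    using assms by (simp add: eq)
  show ?thesis
    using infsum_Sigma'_banach[OF sm] summable_on_Sigma_banach[OF sm]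
    by (simp add: has_sum_iff hls_sum_eq_UNIV eq riesz_potential_def infsum_cmult_right')
qed

subsection \<open>The Euler--Lagrange equation\<close>

lemma has_sum_fun_upd:
  fixes u :: "'a \<Rightarrow> real"
  assumes "(u has_sum S) UNIV"
  shows "((u(i := y)) has_sum (S - u i + y)) UNIV"
proof -
  have "((\<lambda>k. if k = i then y - u i else 0) has_sum (y - u i)) UNIV"
    by (rule has_sum_finite_neutralI[of "{i}"]) auto
  moreover have "(\<lambda>k. u k + (if k = i then y - u i else 0)) = u(i := y)"
    by auto
  moreover have "S - u i + y = S + (y - u i)"
    by simp
  ultimately show ?thesis
    using has_sum_add[OF assms] by metis
qed

lemma hls_sum_fun_upd:
  assumes "hls_term \<alpha> f g summable_on UNIV" "hls_term \<alpha> (f(i := f i + t)) g summable_on UNIV"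
  shows "hls_sum \<alpha> (f(i := f i + t)) g = hls_sum \<alpha> f g + t * riesz_potential \<alpha> g i"
proof -
  have "(\<lambda>k. (f(i := f i + t)) k * riesz_potential \<alpha> g k)
      = (\<lambda>k. f k * riesz_potential \<alpha> g k)(i := (f i + t) * riesz_potential \<alpha> g i)"
    by auto
  then have "((\<lambda>k. (f(i := f i + t)) k * riesz_potential \<alpha> g k) has_sum
      hls_sum \<alpha> f g - f i * riesz_potential \<alpha> g i + (f i + t) * riesz_potential \<alpha> g i) UNIV"
    using has_sum_fun_upd[OF has_sum_riesz_potential[OF assms(1)]] by metis
  from has_sum_unique[OF has_sum_riesz_potential[OF assms(2)] this] show ?thesis
    by (simp add: distrib_right)
qed

lemma has_sum_lp_fun_upd:
  assumes "f \<in> lp_space r"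
  shows "((\<lambda>k. \<bar>(f(i := y)) k\<bar> powr r) has_sum
    ((\<Sum>\<^sub>\<infinity>k. \<bar>f k\<bar> powr r) - \<bar>f i\<bar> powr r + \<bar>y\<bar> powr r)) UNIV"
proof -
  have "(\<lambda>k. \<bar>(f(i := y)) k\<bar> powr r) = (\<lambda>k. \<bar>f k\<bar> powr r)(i := \<bar>y\<bar> powr r)"
    by auto
  then show ?thesis
    using has_sum_fun_upd[of "\<lambda>k. \<bar>f k\<bar> powr r"] assms by (simp add: lp_space_def)
qed

lemma hls_inequalityD:
  assumes "hls_inequality TYPE('n::finite) r s \<alpha> C" "f \<in> lp_space r" "g \<in> lp_space s"
  shows "hls_term \<alpha> f (g :: int ^ 'n \<Rightarrow> real) summable_on UNIV"
    "hls_sum \<alpha> f g \<le> C * lp_norm r f * lp_norm s g"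
  using assms unfolding hls_inequality_def summable_on_off_diagonal_iff by auto

text \<open>
  Perturbing the \<open>i\<close>-th entry of a maximising sequence and passing to the limit shows that
  \<open>C (1 - x^r + (x + t)^r)^(1/r) - C - t \<kappa>\<close> is nonnegative near its zero \<open>t = 0\<close>.
\<close>

lemma euler_lagrange_limit:
  fixes F G :: "nat \<Rightarrow> int ^ 'n::finite \<Rightarrow> real"
  assumes "r > 1" and ineq: "hls_inequality TYPE('n) r s \<alpha> C"
    and F: "\<And>n. F n \<in> lp_space r" "\<And>n. lp_norm r (F n) = 1"
    and G: "\<And>n. G n \<in> lp_space s" "\<And>n. lp_norm s (G n) = 1"
    and max: "(\<lambda>n. hls_sum \<alpha> (F n) (G n)) \<longlonglongrightarrow> C"
    and x: "(\<lambda>n. F n i) \<longlonglongrightarrow> x" "x > 0"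
    and \<kappa>: "(\<lambda>n. riesz_potential \<alpha> (G n) i) \<longlonglongrightarrow> \<kappa>"
  shows "\<kappa> = C * x powr (r - 1)"
proof -
  let ?\<phi> = "\<lambda>t. C * (1 - x powr r + (x + t) powr r) powr (1 / r) - C - t * \<kappa>"
  \<comment> \<open>The range of \<open>t\<close> keeps \<open>x + t\<close> positive, so the
    absolute values disappear from the limit inequality.\<close>
  have "?\<phi> 0 \<le> ?\<phi> t" if t: "\<bar>0 - t\<bar> < x" for t
  proof -
    define b where "b n = 1 - \<bar>F n i\<bar> powr r + \<bar>F n i + t\<bar> powr r" for n
    have upd: "((\<lambda>k. \<bar>((F n)(i := F n i + t)) k\<bar> powr r) has_sum b n) UNIV" for n
      using has_sum_lp_fun_upd[OF F(1)[of n], of i "F n i + t"] F(2)[of n] \<open>r > 1\<close>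
      by (simp add: lp_norm_eq_1_iff b_def)
    then have mem: "(F n)(i := F n i + t) \<in> lp_space r" for n
      unfolding lp_space_def summable_on_def by blast
    have b0: "b n \<ge> 0" for n
      by (rule has_sum_nonneg[OF upd]) auto
    have nrm: "lp_norm r ((F n)(i := F n i + t)) = b n powr (1 / r)" for n
      unfolding lp_norm_def using infsumI[OF upd] by simp
    have le: "hls_sum \<alpha> (F n) (G n) + t * riesz_potential \<alpha> (G n) i \<le> C * b n powr (1 / r)" for n
      using hls_inequalityD[OF ineq mem G(1), of n n] hls_inequalityD(1)[OF ineq F(1) G(1), of n n]
      by (simp add: hls_sum_fun_upd nrm G(2))
    have pw: "(\<lambda>n. \<bar>F n i + u\<bar> powr r) \<longlonglongrightarrow> \<bar>x + u\<bar> powr r" for u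
      by (rule tendsto_powr') (use x \<open>r > 1\<close> in \<open>auto intro!: tendsto_intros\<close>)
    have "b \<longlonglongrightarrow> 1 - \<bar>x\<bar> powr r + \<bar>x + t\<bar> powr r"
      unfolding b_def using pw[of 0] by (intro tendsto_add tendsto_diff tendsto_const pw) simp
    then have "(\<lambda>n. b n powr (1 / r)) \<longlonglongrightarrow> (1 - \<bar>x\<bar> powr r + \<bar>x + t\<bar> powr r) powr (1 / r)"
      by (rule tendsto_powr') (use b0 \<open>r > 1\<close> in auto)
    then have lim: "(\<lambda>n. C * b n powr (1 / r)) \<longlonglongrightarrow> C * (1 - \<bar>x\<bar> powr r + \<bar>x + t\<bar> powr r) powr (1 / r)"
      by (rule tendsto_mult_left)
    have "C + t * \<kappa> \<le> C * (1 - \<bar>x\<bar> powr r + \<bar>x + t\<bar> powr r) powr (1 / r)"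
      by (rule LIMSEQ_le[OF tendsto_add[OF max tendsto_mult_left[OF \<kappa>]] lim]) (use le in auto)
    then show ?thesis
      using x(2) t by simp
  qed
  then have min: "\<forall>t. \<bar>0 - t\<bar> < x \<longrightarrow> ?\<phi> 0 \<le> ?\<phi> t" by blast
  \<comment> \<open>At \<open>t = 0\<close> the base of the outer power is 1, so that power
    contributes only the factor \<open>1 / r\<close>, which cancels the \<open>r\<close> from the
    inner derivative.\<close>
  have "DERIV ?\<phi> 0 :> C * x powr (r - 1) - \<kappa>"
    using \<open>r > 1\<close> x(2) by (auto intro!: derivative_eq_intros simp: powr_diff field_simps)
  from DERIV_local_min[OF this x(2) min] show ?thesis by simp
qed

subsection \<open>Symmetries\<close>

lemma hls_term_commute: "hls_term \<alpha> f g (i, j) = hls_term \<alpha> g f (j, i)"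
  using riesz_kernel_minus[of \<alpha> i j] by (simp add: hls_term_eq)

lemma hls_sum_commute: "hls_sum \<alpha> f g = hls_sum \<alpha> g f"
  and summable_hls_term_commute:
    "hls_term \<alpha> f g summable_on UNIV \<longleftrightarrow> hls_term \<alpha> g f summable_on UNIV"
proof -
  have bij: "bij_betw prod.swap UNIV UNIV" by (rule bij_swap)
  have eq: "hls_term \<alpha> f g = (\<lambda>p. hls_term \<alpha> g f (prod.swap p))"
    by (auto simp: hls_term_commute)
  show "hls_sum \<alpha> f g = hls_sum \<alpha> g f"
    unfolding hls_sum_eq_UNIV eq using infsum_reindex_bij_betw[OF bij] by blast
  show "hls_term \<alpha> f g summable_on UNIV \<longleftrightarrow> hls_term \<alpha> g f summable_on UNIV"
    unfolding eq using summable_on_reindex_bij_betw[OF bij] by blast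
qed

text \<open>The kernel is even, so both factors play the same role. This allows
  \<open>euler_lagrange_limit\<close> to be applied to the second sequence as well.\<close>

lemma hls_inequality_commute:
  assumes "hls_inequality TYPE('n::finite) r s \<alpha> C"
  shows "hls_inequality TYPE('n) s r \<alpha> C"
  unfolding hls_inequality_def summable_on_off_diagonal_iff
proof (intro ballI conjI)
  fix f g :: "int ^ 'n \<Rightarrow> real"
  assume "f \<in> lp_space s" "g \<in> lp_space r"
  from hls_inequalityD[OF assms this(2,1)]
  show "hls_term \<alpha> f g summable_on UNIV" "hls_sum \<alpha> f g \<le> C * lp_norm s f * lp_norm r g"
    by (simp_all add: summable_hls_term_commute[of \<alpha> f g] hls_sum_commute[of \<alpha> f g] mult_ac)
qed

lemma bij_translation: "bij (\<lambda>i :: 'a :: ab_group_add. i + a)"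
  by (rule bij_betwI[where g = "\<lambda>i. i - a"]) auto

lemma lp_space_translate: "f \<in> lp_space r \<Longrightarrow> (\<lambda>i. f (i + a)) \<in> lp_space r"
  using summable_on_reindex_bij_betw[OF bij_translation, of "\<lambda>i. \<bar>f i\<bar> powr r" a]
  by (simp add: lp_space_def)

lemma lp_norm_translate: "lp_norm r (\<lambda>i. f (i + a)) = lp_norm r f"
  using infsum_reindex_bij_betw[OF bij_translation, of "\<lambda>i. \<bar>f i\<bar> powr r" a]
  by (simp add: lp_norm_def)

text \<open>The kernel depends only on \<open>i - j\<close>. This invariance is used to move a large
  entry to the origin.\<close>

lemma hls_sum_translate: "hls_sum \<alpha> (\<lambda>i. f (i + a)) (\<lambda>j. g (j + a)) = hls_sum \<alpha> f g"
proof -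
  have bij: "bij_betw (\<lambda>(i, j). (i + a, j + a)) UNIV UNIV"
    by (rule bij_betwI[where g = "\<lambda>(i, j). (i - a, j - a)"]) auto
  have "hls_term \<alpha> (\<lambda>i. f (i + a)) (\<lambda>j. g (j + a))
      = (\<lambda>p. hls_term \<alpha> f g (case p of (i, j) \<Rightarrow> (i + a, j + a)))"
    by (auto simp: hls_term_eq)
  then show ?thesis
    unfolding hls_sum_eq_UNIV using infsum_reindex_bij_betw[OF bij] by metis
qed

lemma lp_space_abs: "f \<in> lp_space r \<Longrightarrow> (\<lambda>i. \<bar>f i\<bar>) \<in> lp_space r"
  by (simp add: lp_space_def)

lemma lp_norm_abs: "lp_norm r (\<lambda>i. \<bar>f i\<bar>) = lp_norm r f"
  by (simp add: lp_norm_def)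

text \<open>The kernel is nonnegative, so passing to absolute values can only help a maximising
  sequence.\<close>

lemma hls_sum_le_abs:
  assumes "hls_term \<alpha> f g summable_on UNIV"
    and "hls_term \<alpha> (\<lambda>i. \<bar>f i\<bar>) (\<lambda>j. \<bar>g j\<bar>) summable_on UNIV"
  shows "hls_sum \<alpha> f g \<le> hls_sum \<alpha> (\<lambda>i. \<bar>f i\<bar>) (\<lambda>j. \<bar>g j\<bar>)"
  unfolding hls_sum_eq_UNIV
proof (rule infsum_mono[OF assms])
  fix p :: "(int ^ 'a) \<times> (int ^ 'a)"
  show "hls_term \<alpha> f g p \<le> hls_term \<alpha> (\<lambda>i. \<bar>f i\<bar>) (\<lambda>j. \<bar>g j\<bar>) p"
    by (cases p) (auto simp: hls_term_eq simp flip: abs_mult intro!: mult_right_mono)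
qed

lemma abs_le_lp_norm:
  assumes "r > 0" "f \<in> lp_space r"
  shows "\<bar>f i\<bar> \<le> lp_norm r f"
proof -
  have "\<bar>f i\<bar> powr r \<le> (\<Sum>\<^sub>\<infinity>i. \<bar>f i\<bar> powr r)"
    using finite_sum_le_infsum[of "\<lambda>i. \<bar>f i\<bar> powr r" UNIV "{i}"] assms by (simp add: lp_space_def)
  also have "\<dots> = lp_norm r f powr r"
    using assms by (simp add: lp_norm_powr)
  finally show ?thesis
    using assms powr_less_mono2[of r "lp_norm r f" "\<bar>f i\<bar>"] by force
qed

subsection \<open>The best constant and maximising sequences\<close>

lemma indicator_in_lp_space: "(\<lambda>k. if k = a then 1 else 0) \<in> lp_space r"
  and lp_norm_indicator: "lp_norm r (\<lambda>k. if k = a then 1 else 0) = 1"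
proof -
  have "((\<lambda>k. \<bar>if k = a then 1 else 0 :: real\<bar> powr r) has_sum 1) UNIV"
    by (rule has_sum_finite_neutralI[of "{a}"]) auto
  then show "(\<lambda>k. if k = a then 1 else 0) \<in> lp_space r"
    "lp_norm r (\<lambda>k. if k = a then 1 else 0) = 1"
    by (auto simp: lp_space_def lp_norm_def has_sum_iff)
qed

lemma hls_sum_indicator:
  "hls_sum \<alpha> (\<lambda>k. if k = a then 1 else 0) (\<lambda>k. if k = b then 1 else 0) = riesz_kernel \<alpha> (a - b)"
  unfolding hls_sum_eq_UNIV
  by (rule infsumI, rule has_sum_finite_neutralI[of "{(a, b)}"])
    (auto simp: hls_term_eq split: if_splits)

text \<open>Point masses at two distinct lattice points bound \<open>C\<close> below by a positive
  value of the kernel.\<close>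

lemma hls_inequality_pos:
  assumes "hls_inequality TYPE('n::finite) r s \<alpha> C"
  shows "C > 0"
proof -
  define b :: "int ^ 'n" where "b = (\<chi> k. 1)"
  have "b \<noteq> 0"
    by (auto simp: b_def vec_eq_iff)
  then have "0 < riesz_kernel \<alpha> (b - 0)"
    by (simp add: riesz_kernel_def)
  also have "\<dots> \<le> C"
    using hls_inequalityD(2)[OF assms indicator_in_lp_space indicator_in_lp_space, of b 0]
    by (simp add: hls_sum_indicator lp_norm_indicator)
  finally show ?thesis .
qed

text \<open>\<open>LEAST\<close> over the reals is informative only if a minimum exists. The infimum
  of the admissible constants is itself admissible, because for each fixed pair the inequality is a
  closed condition on the constant.\<close>

lemma hls_best_constant_least:
  fixes r s \<alpha> C\<^sub>0 :: real
  assumes "hls_inequality TYPE('n::finite) r s \<alpha> C\<^sub>0"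
  defines "C \<equiv> hls_best_constant TYPE('n) r s \<alpha>"
  shows "hls_inequality TYPE('n) r s \<alpha> C" "\<And>D. hls_inequality TYPE('n) r s \<alpha> D \<Longrightarrow> C \<le> D"
proof -
  define S where "S = {C. hls_inequality TYPE('n) r s \<alpha> C}"
  have bdd: "bdd_below S"
    unfolding S_def by (rule bdd_belowI[of _ 0]) (auto dest!: hls_inequality_pos)
  have Inf: "hls_inequality TYPE('n) r s \<alpha> (Inf S)"
    unfolding hls_inequality_def summable_on_off_diagonal_iff
  proof (intro ballI conjI)
    fix f g :: "int ^ 'n \<Rightarrow> real"
    assume fg: "f \<in> lp_space r" "g \<in> lp_space s"
    show "hls_term \<alpha> f g summable_on UNIV"
      using hls_inequalityD(1)[OF assms(1) fg] .
    show "hls_sum \<alpha> f g \<le> Inf S * lp_norm r f * lp_norm s g"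
    proof (cases "lp_norm r f * lp_norm s g = 0")
      case True
      then show ?thesis using hls_inequalityD(2)[OF assms(1) fg] by (auto simp: mult.assoc)
    next
      case False
      then have pos: "lp_norm r f * lp_norm s g > 0"
        by (metis lp_norm_nonneg mult_nonneg_nonneg order_less_le)
      have "hls_sum \<alpha> f g / (lp_norm r f * lp_norm s g) \<le> Inf S"
      proof (rule cInf_greatest)
        show "S \<noteq> {}" using assms by (auto simp: S_def)
        show "hls_sum \<alpha> f g / (lp_norm r f * lp_norm s g) \<le> D" if "D \<in> S" for D
          using hls_inequalityD(2)[OF _ fg, of \<alpha> D] that pos by (simp add: S_def divide_le_eq mult.assoc)
      qed
      then show ?thesis using pos by (simp add: divide_le_eq mult.assoc)
    qed
  qed
  have "C = Inf S"
    unfolding C_def hls_best_constant_def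
    by (rule Least_equality) (use Inf bdd in \<open>auto simp: S_def intro: cInf_lower\<close>)
  then show "hls_inequality TYPE('n) r s \<alpha> C" "\<And>D. hls_inequality TYPE('n) r s \<alpha> D \<Longrightarrow> C \<le> D"
    using Inf bdd by (auto simp: S_def intro: cInf_lower)
qed

text \<open>
  The strict inequality between the exponents survives replacing \<open>r\<close> by a slightly larger \<open>r'\<close>,
  and the sum of \<open>\<bar>f i\<bar>^r'\<close> is at most \<open>(sup \<bar>f\<bar>)^(r' - r)\<close> times that of \<open>\<bar>f i\<bar>^r\<close>.
  Hence a pair in which \<open>f\<close> has only small entries cannot be nearly optimal.
\<close>

lemma hls_nonvanishing:
  fixes r s \<alpha> d :: real
  assumes "r > 1" and "s > 1" and "0 < \<alpha>" and "\<alpha> < real CARD('n::finite)"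
    and "1 / r + 1 / s + (real CARD('n) - \<alpha>) / real CARD('n) > 2" and "d > 0"
  obtains c where "c > 0"
    and "\<And>f g :: int ^ 'n \<Rightarrow> real. f \<in> lp_space r \<Longrightarrow> g \<in> lp_space s \<Longrightarrow> lp_norm r f = 1 \<Longrightarrow>
      lp_norm s g = 1 \<Longrightarrow> d \<le> hls_sum \<alpha> f g \<Longrightarrow> \<exists>i. c \<le> \<bar>f i\<bar>"
proof -
  define \<mu> where "\<mu> = (real CARD('n) - \<alpha>) / real CARD('n)"
  \<comment> \<open>The reciprocal \<open>1 / r\<close> is lowered by half of the surplus over 2, so
    the strict inequality survives. The surplus is below \<open>1 / r\<close>, which keeps
    \<open>q\<close> positive.\<close>
  define q where "q = 1 / r - (1 / r + 1 / s + \<mu> - 2) / 2"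
  define r' where "r' = 1 / q"
  have "1 / s < 1" "\<mu> < 1" "1 / r > 0" "1 / r + 1 / s + \<mu> > 2"
    using assms by (simp_all add: \<mu>_def)
  then have q: "0 < q" "q < 1 / r" "q + 1 / s + \<mu> > 2"
    unfolding q_def by argo+
  have r': "r' > r" "1 / r' = q"
    using q assms by (auto simp: r'_def field_simps)
  have "1 / r' + 1 / s + (real CARD('n) - \<alpha>) / real CARD('n) > 2"
    using q(3) unfolding r'(2) \<mu>_def .
  then obtain D where D: "hls_inequality TYPE('n) r' s \<alpha> D"
    using hls_inequality_exists[of r' s \<alpha>] assms r' by auto
  have D0: "D > 0" using hls_inequality_pos[OF D] .
  define e where "e = (r' - r) / r'"
  have e: "e > 0" using r' assms by (simp add: e_def)
  \<comment> \<open>Chosen so that \<open>D * c powr e = d / 2\<close>, where \<open>e\<close> is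
    the exponent with which the supremum of \<open>f\<close> enters its \<open>l^r'\<close> norm.
    Entries below \<open>c\<close> would then force \<open>d \<le> d / 2\<close>.\<close>
  define c where "c = (d / (2 * D)) powr (1 / e)"
  have c: "c > 0" "c powr e = d / (2 * D)"
    using D0 \<open>d > 0\<close> e by (simp_all add: c_def powr_powr)
  show ?thesis
  proof (rule that[OF c(1)], rule ccontr)
    fix f g :: "int ^ 'n \<Rightarrow> real"
    assume f: "f \<in> lp_space r" "lp_norm r f = 1" and g: "g \<in> lp_space s" "lp_norm s g = 1"
      and d: "d \<le> hls_sum \<alpha> f g" and "\<nexists>i. c \<le> \<bar>f i\<bar>"
    then have small: "\<bar>f i\<bar> < c" for i by (simp add: not_le)
    have le: "\<bar>f i\<bar> powr r' \<le> c powr (r' - r) * \<bar>f i\<bar> powr r" for i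
    proof -
      have "\<bar>f i\<bar> powr r' = \<bar>f i\<bar> powr (r' - r) * \<bar>f i\<bar> powr r"
        by (simp flip: powr_add)
      also have "\<dots> \<le> c powr (r' - r) * \<bar>f i\<bar> powr r"
        by (intro mult_right_mono powr_mono2) (use small[of i] r' in auto)
      finally show ?thesis .
    qed
    have sm: "(\<lambda>i. c powr (r' - r) * \<bar>f i\<bar> powr r) summable_on UNIV"
      using f(1) by (auto simp: lp_space_def intro: summable_on_cmult_right)
    have f': "f \<in> lp_space r'"
      unfolding lp_space_def mem_Collect_eq
      by (rule summable_on_comparison_test[OF sm]) (use le in auto)
    have "(\<Sum>\<^sub>\<infinity>i. \<bar>f i\<bar> powr r') \<le> (\<Sum>\<^sub>\<infinity>i. c powr (r' - r) * \<bar>f i\<bar> powr r)"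
      by (rule infsum_mono) (use f' sm le in \<open>auto simp: lp_space_def\<close>)
    also have "\<dots> = c powr (r' - r)"
      using f(2) assms by (simp add: infsum_cmult_right' lp_norm_eq_1_iff)
    finally have "lp_norm r' f \<le> (c powr (r' - r)) powr (1 / r')"
      unfolding lp_norm_def by (intro powr_mono2 infsum_abs_powr_nonneg) (use r' assms in auto)
    also have "\<dots> = c powr e"
      by (simp add: powr_powr e_def)
    finally have "D * lp_norm r' f \<le> D * (d / (2 * D))"
      unfolding c(2) using D0 by (intro mult_left_mono) auto
    moreover have "d \<le> D * lp_norm r' f"
      using hls_inequalityD(2)[OF D f' g(1)] d g(2) by simp
    ultimately show False
      using D0 \<open>d > 0\<close> by simp
  qed
qed

text \<open>The condition on the kernel says that it lies in \<open>l^p\<close> for the exponent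
  \<open>p\<close> conjugate to \<open>s\<close>, so \<open>infsum_mult_tendsto\<close> applies to
  its reflected translates.\<close>

lemma riesz_potential_tendsto:
  fixes G :: "nat \<Rightarrow> int ^ 'n::finite \<Rightarrow> real"
  assumes "s > 1" and kernel: "(real CARD('n) - \<alpha>) / real CARD('n) > 1 - 1 / s"
    and G: "\<And>n. G n \<in> lp_space s" "\<And>n. lp_norm s (G n) = 1" "\<And>n j. G n j \<ge> 0"
    and lim: "\<And>j. (\<lambda>n. G n j) \<longlonglongrightarrow> g j"
  shows "(\<lambda>n. riesz_potential \<alpha> (G n) i) \<longlonglongrightarrow> riesz_potential \<alpha> g i"
proof -
  define p where "p = s / (s - 1)"
  have p: "p > 1" "1 / p + 1 / s = 1"
    using \<open>s > 1\<close> by (auto simp: p_def field_simps)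
  have ip: "1 - 1 / s = 1 / p" using p by linarith
  have "(real CARD('n) - \<alpha>) * p > real CARD('n)"
    using kernel p(1) unfolding ip by (simp add: field_simps)
  then have "(\<lambda>k :: int ^ 'n. riesz_kernel \<alpha> k powr p) summable_on UNIV"
    using p by (intro riesz_kernel_powr_summable) auto
  moreover have "bij (\<lambda>j. i - j)"
    by (rule bij_betwI[where g = "\<lambda>j. i - j"]) auto
  ultimately have "(\<lambda>j. riesz_kernel \<alpha> (i - j) powr p) summable_on UNIV"
    using summable_on_reindex_bij_betw[of "\<lambda>j. i - j" UNIV UNIV "\<lambda>k. riesz_kernel \<alpha> k powr p"]
    by simp
  then show ?thesis
    unfolding riesz_potential_def
    using G \<open>s > 1\<close> p lim
    by (intro infsum_mult_tendsto[of p s]) (auto simp: lp_norm_eq_1_iff lp_space_def)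
qed

text \<open>Any constant below \<open>C\<close> is violated by some pair. Normalising, taking
  absolute values and translating turn such pairs into a nonnegative maximising sequence whose first
  components stay bounded away from 0 at the origin.\<close>

lemma maximizing_sequence:
  fixes r s \<alpha> :: real
  assumes "r > 1" and "s > 1" and "0 < \<alpha>" and "\<alpha> < real CARD('n::finite)"
    and "1 / r + 1 / s + (real CARD('n) - \<alpha>) / real CARD('n) > 2"
  defines "C \<equiv> hls_best_constant TYPE('n) r s \<alpha>"
  obtains c and F G :: "nat \<Rightarrow> int ^ 'n \<Rightarrow> real"
  where "c > 0" "\<And>n. F n \<in> lp_space r" "\<And>n. lp_norm r (F n) = 1" "\<And>n i. F n i \<ge> 0"
    "\<And>n. G n \<in> lp_space s" "\<And>n. lp_norm s (G n) = 1" "\<And>n i. G n i \<ge> 0"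
    "(\<lambda>n. hls_sum \<alpha> (F n) (G n)) \<longlonglongrightarrow> C" "\<And>n. F n 0 \<ge> c"
proof -
  obtain C\<^sub>0 where "hls_inequality TYPE('n) r s \<alpha> C\<^sub>0"
    using hls_inequality_exists assms by blast
  note C = hls_best_constant_least[OF this, folded C_def]
  have C0: "C > 0" using hls_inequality_pos[OF C(1)] .
  obtain c where c: "c > 0"
    "\<And>f g :: int ^ 'n \<Rightarrow> real. f \<in> lp_space r \<Longrightarrow> g \<in> lp_space s \<Longrightarrow> lp_norm r f = 1 \<Longrightarrow>
      lp_norm s g = 1 \<Longrightarrow> C / 2 \<le> hls_sum \<alpha> f g \<Longrightarrow> \<exists>i. c \<le> \<bar>f i\<bar>"
    using hls_nonvanishing[OF assms(1-5), of "C / 2"] C0 by auto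
  \<comment> \<open>The slack never exceeds \<open>C / 2\<close>, so one threshold \<open>c\<close>
    from \<open>hls_nonvanishing\<close> serves every \<open>n\<close>.\<close>
  have "\<exists>f g :: int ^ 'n \<Rightarrow> real. f \<in> lp_space r \<and> lp_norm r f = 1 \<and> (\<forall>i. f i \<ge> 0) \<and>
      g \<in> lp_space s \<and> lp_norm s g = 1 \<and> (\<forall>i. g i \<ge> 0) \<and>
      C - C / 2 * inverse (real (Suc n)) \<le> hls_sum \<alpha> f g \<and> f 0 \<ge> c" for n
  proof -
    define D where "D = C - C / 2 * inverse (real (Suc n))"
    have "D < C" using C0 by (simp add: D_def)
    have "D \<ge> C / 2"
    proof -
      have "C / 2 * inverse (real (Suc n)) \<le> C / 2 * 1"
        using C0 by (intro mult_left_mono) (auto simp: inverse_le_1_iff)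
      then show ?thesis by (simp add: D_def)
    qed
    from \<open>D < C\<close> have "\<not> hls_inequality TYPE('n) r s \<alpha> D"
      using C(2) by force
    \<comment> \<open>Summability does not involve the constant, so the failure must come from the
      bound.\<close>
    then obtain f g :: "int ^ 'n \<Rightarrow> real" where fg: "f \<in> lp_space r" "g \<in> lp_space s"
      "\<not> hls_sum \<alpha> f g \<le> D * lp_norm r f * lp_norm s g"
      using hls_inequalityD(1)[OF C(1)]
      unfolding hls_inequality_def summable_on_off_diagonal_iff by blast
    have "lp_norm r f \<noteq> 0" "lp_norm s g \<noteq> 0"
      using fg lp_norm_eq_0D[of r f] lp_norm_eq_0D[of s g] assms(1,2) by fastforce+
    then obtain f' g' :: "int ^ 'n \<Rightarrow> real" where *: "f' \<in> lp_space r" "g' \<in> lp_space s"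
      "lp_norm r f' = 1" "lp_norm s g' = 1"
      "hls_sum \<alpha> f g = hls_sum \<alpha> f' g' * lp_norm r f * lp_norm s g"
      using hls_normalize[of r s f g \<alpha>] fg assms(1,2) by auto
    have "D \<le> hls_sum \<alpha> f' g'"
    proof (rule ccontr)
      assume "\<not> D \<le> hls_sum \<alpha> f' g'"
      then have "hls_sum \<alpha> f g \<le> D * lp_norm r f * lp_norm s g"
        unfolding *(5) by (intro mult_right_mono) auto
      with fg(3) show False by simp
    qed
    also have "\<dots> \<le> hls_sum \<alpha> (\<lambda>i. \<bar>f' i\<bar>) (\<lambda>j. \<bar>g' j\<bar>)"
      using hls_inequalityD(1)[OF C(1)] * by (intro hls_sum_le_abs) (auto intro: lp_space_abs)
    finally have D: "D \<le> hls_sum \<alpha> (\<lambda>i. \<bar>f' i\<bar>) (\<lambda>j. \<bar>g' j\<bar>)" .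
    obtain a where a: "c \<le> \<bar>f' a\<bar>"
      using c(2)[of "\<lambda>i. \<bar>f' i\<bar>" "\<lambda>j. \<bar>g' j\<bar>"] D * \<open>D \<ge> C / 2\<close>
      by (auto simp: lp_norm_abs lp_space_abs)
    show ?thesis
      by (rule exI[of _ "\<lambda>i. \<bar>f' (i + a)\<bar>"], rule exI[of _ "\<lambda>i. \<bar>g' (i + a)\<bar>"])
        (use * D a hls_sum_translate[of \<alpha> "\<lambda>i. \<bar>f' i\<bar>" a "\<lambda>i. \<bar>g' i\<bar>"] in
          \<open>auto simp: lp_norm_translate lp_norm_abs D_def intro!: lp_space_abs lp_space_translate\<close>)
  qed
  then obtain F G :: "nat \<Rightarrow> int ^ 'n \<Rightarrow> real" where
    FG: "\<And>n. F n \<in> lp_space r" "\<And>n. lp_norm r (F n) = 1" "\<And>n i. F n i \<ge> 0"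
    "\<And>n. G n \<in> lp_space s" "\<And>n. lp_norm s (G n) = 1" "\<And>n i. G n i \<ge> 0"
    "\<And>n. C - C / 2 * inverse (real (Suc n)) \<le> hls_sum \<alpha> (F n) (G n)" "\<And>n. F n 0 \<ge> c"
    by metis
  have "(\<lambda>n. hls_sum \<alpha> (F n) (G n)) \<longlonglongrightarrow> C"
  proof (rule tendsto_sandwich)
    have "(\<lambda>n. C - C / 2 * inverse (real (Suc n))) \<longlonglongrightarrow> C - C / 2 * 0"
      by (intro tendsto_intros LIMSEQ_inverse_real_of_nat)
    then show "(\<lambda>n. C - C / 2 * inverse (real (Suc n))) \<longlonglongrightarrow> C" by simp
    show "\<forall>\<^sub>F n in sequentially. hls_sum \<alpha> (F n) (G n) \<le> C"
      using hls_inequalityD(2)[OF C(1) FG(1,4)] FG(2,5) by (intro always_eventually) simp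
  qed (use FG in auto)
  then show ?thesis using that[of c F G] c(1) FG by blast
qed

section \<open>Passage to the limit in a maximising sequence\<close>

theorem theorem1p1:
  fixes r s \<alpha> :: real
  assumes "r > 1" and "s > 1"
    and "0 < \<alpha>" and "\<alpha> < real CARD('n::finite)"
    and "1 / r + 1 / s + (real CARD('n) - \<alpha>) / real CARD('n) > 2"
  shows "\<exists>f \<in> lp_space r. \<exists>g \<in> lp_space s.
           lp_norm r f = 1 \<and> lp_norm s g = 1 \<and>
           hls_sum \<alpha> f (g :: int ^ 'n \<Rightarrow> real) = hls_best_constant TYPE('n) r s \<alpha>"
proof -
  define C where "C = hls_best_constant TYPE('n) r s \<alpha>"
  obtain C\<^sub>0 where "hls_inequality TYPE('n) r s \<alpha> C\<^sub>0"
    using hls_inequality_exists assms by blast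
  note C = hls_best_constant_least(1)[OF this, folded C_def]
  have C0: "C > 0" using hls_inequality_pos[OF C] .
  obtain c and F\<^sub>0 G\<^sub>0 :: "nat \<Rightarrow> int ^ 'n \<Rightarrow> real"
    where c: "c > 0"
    and F\<^sub>0: "\<And>n. F\<^sub>0 n \<in> lp_space r" "\<And>n. lp_norm r (F\<^sub>0 n) = 1" "\<And>n i. F\<^sub>0 n i \<ge> 0"
    and G\<^sub>0: "\<And>n. G\<^sub>0 n \<in> lp_space s" "\<And>n. lp_norm s (G\<^sub>0 n) = 1" "\<And>n i. G\<^sub>0 n i \<ge> 0"
    and FG\<^sub>0: "(\<lambda>n. hls_sum \<alpha> (F\<^sub>0 n) (G\<^sub>0 n)) \<longlonglongrightarrow> C" and F\<^sub>00: "\<And>n. F\<^sub>0 n 0 \<ge> c"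
    using maximizing_sequence[OF assms, folded C_def] by blast
  have "norm (F\<^sub>0 n i, G\<^sub>0 n i) \<le> 2" for n i
  proof -
    have "\<bar>F\<^sub>0 n i\<bar> \<le> 1" "\<bar>G\<^sub>0 n i\<bar> \<le> 1"
      using abs_le_lp_norm[of r "F\<^sub>0 n" i] abs_le_lp_norm[of s "G\<^sub>0 n" i] F\<^sub>0 G\<^sub>0 assms(1,2) by simp_all
    then show ?thesis using norm_Pair_le[of "F\<^sub>0 n i" "G\<^sub>0 n i"] by simp
  qed
  \<comment> \<open>Pairing the entries lets a single diagonal extraction over the countable lattice
    serve both sequences.\<close>
  then obtain \<sigma> :: "nat \<Rightarrow> nat" where \<sigma>: "strict_mono \<sigma>"
    "\<And>i. \<exists>l. (\<lambda>n. (F\<^sub>0 (\<sigma> n) i, G\<^sub>0 (\<sigma> n) i)) \<longlonglongrightarrow> l"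
    using function_convergent_subsequence[of "UNIV :: (int ^ 'n) set" "\<lambda>n i. (F\<^sub>0 n i, G\<^sub>0 n i)" 2]
    by (metis UNIV_I countableI_type)
  then obtain l where l: "\<And>i. (\<lambda>n. (F\<^sub>0 (\<sigma> n) i, G\<^sub>0 (\<sigma> n) i)) \<longlonglongrightarrow> l i"
    by metis
  define F where "F n = F\<^sub>0 (\<sigma> n)" for n
  define G where "G n = G\<^sub>0 (\<sigma> n)" for n
  define f where "f i = fst (l i)" for i
  define g where "g i = snd (l i)" for i
  have F: "\<And>n. F n \<in> lp_space r" "\<And>n. lp_norm r (F n) = 1" "\<And>n i. F n i \<ge> 0"
    and G: "\<And>n. G n \<in> lp_space s" "\<And>n. lp_norm s (G n) = 1" "\<And>n i. G n i \<ge> 0"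
    using F\<^sub>0 G\<^sub>0 by (simp_all add: F_def G_def)
  have max: "(\<lambda>n. hls_sum \<alpha> (F n) (G n)) \<longlonglongrightarrow> C"
    using LIMSEQ_subseq_LIMSEQ[OF FG\<^sub>0 \<sigma>(1)] by (simp add: o_def F_def G_def)
  have f: "(\<lambda>n. F n i) \<longlonglongrightarrow> f i" and g: "(\<lambda>n. G n i) \<longlonglongrightarrow> g i" for i
    using tendsto_fst[OF l[of i]] tendsto_snd[OF l[of i]] by (simp_all add: F_def G_def f_def g_def)
  have f0: "f i \<ge> 0" and g0: "g i \<ge> 0" for i
    using LIMSEQ_le_const[OF f[of i]] LIMSEQ_le_const[OF g[of i]] F(3) G(3) by blast+
  \<comment> \<open>The lower bound at the origin survives the pointwise limit and keeps
    \<open>f\<close> from vanishing.\<close>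
  have "f 0 \<ge> c"
    using LIMSEQ_le_const[OF f[of 0]] F\<^sub>00 by (auto simp: F_def)
  define a where "a = (\<Sum>\<^sub>\<infinity>i. \<bar>f i\<bar> powr r)"
  define b where "b = (\<Sum>\<^sub>\<infinity>i. \<bar>g i\<bar> powr s)"
  \<comment> \<open>Mass may escape to infinity in a pointwise limit, so at this stage only
    \<open>a \<le> 1\<close> is available.\<close>
  have fr: "f \<in> lp_space r" and a1: "a \<le> 1"
    using infsum_powr_le_limit[of r F 1 f] F f assms(1)
    by (simp_all add: lp_space_def a_def lp_norm_eq_1_iff)
  have gs: "g \<in> lp_space s"
    using infsum_powr_le_limit[of s G 1 g] G g assms(2)
    by (simp_all add: lp_space_def lp_norm_eq_1_iff)
  have a0: "a > 0"
  proof -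
    have "0 < \<bar>f 0\<bar>" using \<open>f 0 \<ge> c\<close> c by simp
    then have "lp_norm r f > 0"
      using abs_le_lp_norm[OF _ fr, of 0] assms(1) by simp
    then have "lp_norm r f powr r > 0" by simp
    then show ?thesis using lp_norm_powr[of r f] assms(1) by (simp add: a_def)
  qed
  \<comment> \<open>Three numbers below 1 with sum above 2 have pairwise sums above 1. This yields
    the kernel condition for both potentials and the superadditivity used at the end.\<close>
  have "(real CARD('n) - \<alpha>) / real CARD('n) < 1" "1 / r < 1" "1 / s < 1"
    using assms by simp_all
  with assms(5) have lam: "(real CARD('n) - \<alpha>) / real CARD('n) > 1 - 1 / r"
    "(real CARD('n) - \<alpha>) / real CARD('n) > 1 - 1 / s" "1 / r + 1 / s > 1"
    by argo+
  have pot_g: "(\<lambda>n. riesz_potential \<alpha> (G n) i) \<longlonglongrightarrow> riesz_potential \<alpha> g i" for i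
    by (rule riesz_potential_tendsto[OF assms(2) lam(2) G g])
  have pot_f: "(\<lambda>n. riesz_potential \<alpha> (F n) i) \<longlonglongrightarrow> riesz_potential \<alpha> f i" for i
    by (rule riesz_potential_tendsto[OF assms(1) lam(1) F f])
  \<comment> \<open>Where \<open>f i = 0\<close> both sides vanish, so the perturbation argument is
    needed only at positive entries.\<close>
  have EL_f: "f i * riesz_potential \<alpha> g i = C * \<bar>f i\<bar> powr r" for i
  proof (cases "f i = 0")
    case False
    then have "f i > 0" using f0[of i] by simp
    from euler_lagrange_limit[OF assms(1) C F(1,2) G(1,2) max f this pot_g]
    show ?thesis using \<open>f i > 0\<close> by (simp add: powr_mult_base)
  qed simp
  have max': "(\<lambda>n. hls_sum \<alpha> (G n) (F n)) \<longlonglongrightarrow> C"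
    using max by (simp add: hls_sum_commute[of \<alpha> "G _"])
  have EL_g: "g i * riesz_potential \<alpha> f i = C * \<bar>g i\<bar> powr s" for i
  proof (cases "g i = 0")
    case False
    then have "g i > 0" using g0[of i] by simp
    from euler_lagrange_limit[OF assms(2) hls_inequality_commute[OF C] G(1,2) F(1,2) max' g this pot_f]
    show ?thesis using \<open>g i > 0\<close> by (simp add: powr_mult_base)
  qed simp
  have sm: "hls_term \<alpha> f g summable_on UNIV" "hls_term \<alpha> g f summable_on UNIV"
    using hls_inequalityD(1)[OF C fr gs] summable_hls_term_commute by blast+
  \<comment> \<open>The value at the limit pair comes from summing the Euler--Lagrange equations, so
    no convergence of the double series along the sequence is required.\<close>
  have Ba: "hls_sum \<alpha> f g = C * a"
    using infsumI[OF has_sum_riesz_potential[OF sm(1)]] by (simp add: EL_f infsum_cmult_right' a_def)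
  have Bb: "hls_sum \<alpha> f g = C * b"
    using infsumI[OF has_sum_riesz_potential[OF sm(2)]]
    by (simp add: EL_g infsum_cmult_right' b_def hls_sum_commute[of \<alpha> f g])
  have ab: "a = b" using Ba Bb C0 by simp
  have "C * a \<le> C * lp_norm r f * lp_norm s g"
    using hls_inequalityD(2)[OF C fr gs] Ba by simp
  also have "\<dots> = C * a powr (1 / r + 1 / s)"
    by (simp add: lp_norm_def powr_add ab flip: a_def b_def)
  finally have le: "a powr 1 \<le> a powr (1 / r + 1 / s)"
    using C0 a0 by simp
  have "a = 1"
  proof (rule ccontr)
    assume "a \<noteq> 1"
    have "a powr (1 / r + 1 / s) < a powr 1"
      by (rule powr_less_mono') (use \<open>a \<noteq> 1\<close> a0 a1 lam(3) in auto)
    with le show False by simp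
  qed
  then have "lp_norm r f = 1" "lp_norm s g = 1" "hls_sum \<alpha> f g = C"
    using ab Ba by (simp_all add: lp_norm_def flip: a_def b_def)
  then show ?thesis
    using fr gs unfolding C_def by blast
qed

end
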